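(* Let $f,m\in R[x]$ be polynomials with $1\le\deg(f)<\deg(m)$. Let $M_1,M_2\in R_1[x]$ be such that $m\equiv M_1\cdot M_2\pmod p$ is an $f$-decomposition of $mR_1[x]$, that is, the ideal $fR_1[x]$ is coprime with $M_1$, and $f\in\mathrm{rad}(M_2)$. Then for any $e\ge 1$ there exist $m_1,m_2\in R_e[x]$ with $\bar m_1=M_1$, $\bar m_2=M_2$ and $m\equiv m_1\cdot m_2\pmod{p^e}$ such that the system $(R_e[x]/\langle m\rangle,\Gamma_e(f,m))$ decomposes as $$(R_e[x]/\langle m\rangle,\Gamma_e(f,m))\cong (R_e[x]/\langle m_2\rangle,\Gamma_e(f,m_2))\otimes(R_e[x]/\langle m_1\rangle,\Gamma_e(f,m_1)),$$ where $\Gamma_e(f,m_2)$ is nilpotent and $\Gamma_e(f,m_1)$ is bijective.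
   Context: Let $p$ be a prime, $h\in\mathbb{Z}[t]$ monic of degree $d\ge1$ and irreducible modulo $p$, $q=p^d$, and $R=\mathbb{Z}[t]/\langle h\rangle$. For $e\ge1$ let $R_e=R/\langle p^e\rangle$ (the Galois ring of characteristic $p^e$ and extension degree $d$); $R_1=\mathbb{F}_q$. A polynomial over $R$ is identified with its image over $R_e$ (coefficientwise reduction mod $p^e$) when used in $R_e[x]$; $\bar z$ denotes reduction mod $p$ of a polynomial $z$ over $R$ or $R_e$. For a polynomial and an element of $R_e[x]$, a congruence mod $p^e$ means equality of images in $R_e[x]$. Two ideals $I,J$ of a commutative ring $S$ are coprime if $I+J=S$; an element is identified with the principal ideal it generates. $\mathrm{rad}(I)=\{r\in S: r^n\in I\text{ for some } n\ge1\}$. An $f$-decomposition of an ideal $I$ of $S$ is a factorization $I=I_1\cdot I_2$ with $fS$ coprime to $I_1$ and $f\in\mathrm{rad}(I_2)$. A (finite) dynamical system is a pair $(X,\Gamma)$ with $\Gamma:X\to X$; $(X,\Gamma_1)\cong(Y,\Gamma_2)$ means there is a bijection $\varphi:X\to Y$ with $\Gamma_2=\varphi\circ\Gamma_1\circ\varphi^{-1}$. The product is $(X,\Gamma_1)\otimes(Y,\Gamma_2)=(X\times Y,\Gamma_1\times\Gamma_2)$ with $(\Gamma_1\times\Gamma_2)(x,y)=(\Gamma_1(x),\Gamma_2(y))$. $\Gamma_e(f,g)$ denotes the map $R_e[x]/\langle g\rangle\to R_e[x]/\langle g\rangle$, $z\mapsto fz$. A linear map is nilpotent if some iterate of it is the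 zero map. *)

theory Defs
  imports "HOL-Algebra.Algebra"
begin

type_synonym 'a dynsys = "'a set \<times> ('a \<Rightarrow> 'a)"

definition dynsys_iso :: "'a dynsys \<Rightarrow> 'b dynsys \<Rightarrow> bool"  (infix "\<cong>\<^sub>d" 50)
  where "S \<cong>\<^sub>d T \<longleftrightarrow>
    (\<exists>\<phi>. bij_betw \<phi> (fst S) (fst T) \<and>
         (\<forall>y\<in>fst T. snd T y = \<phi> (snd S (inv_into (fst S) \<phi> y))))"

definition dynsys_prod :: "'a dynsys \<Rightarrow> 'b dynsys \<Rightarrow> ('a \<times> 'b) dynsys"  (infixr "\<otimes>\<^sub>d" 80)
  where "S \<otimes>\<^sub>d T = (fst S \<times> fst T, map_prod (snd S) (snd T))"

definition coprime_ideals :: "('a, 'b) ring_scheme \<Rightarrow> 'a set \<Rightarrow> 'a set \<Rightarrow> bool"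
  where "coprime_ideals S I J \<longleftrightarrow> I <+>\<^bsub>S\<^esub> J = carrier S"

definition rad_ideal :: "('a, 'b) ring_scheme \<Rightarrow> 'a set \<Rightarrow> 'a set"
  where "rad_ideal S I = {r \<in> carrier S. \<exists>n::nat. n \<ge> 1 \<and> r [^]\<^bsub>S\<^esub> n \<in> I}"

definition f_decomposition ::
    "('a, 'b) ring_scheme \<Rightarrow> 'a \<Rightarrow> 'a set \<Rightarrow> 'a set \<Rightarrow> 'a set \<Rightarrow> bool"
  where "f_decomposition S f I I1 I2 \<longleftrightarrow>
    ideal I S \<and> ideal I1 S \<and> ideal I2 S \<and>
    I = I1 \<cdot>\<^bsub>S\<^esub> I2 \<and>
    coprime_ideals S (PIdl\<^bsub>S\<^esub> f) I1 \<and>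
    f \<in> rad_ideal S I2"

text \<open>Elements of \<^const>\<open>UP\<close> are coefficient functions, so coefficientwise application
  of a map is composition.\<close>

definition map_coeffs :: "('a \<Rightarrow> 'b) \<Rightarrow> (nat \<Rightarrow> 'a) \<Rightarrow> nat \<Rightarrow> 'b"
  where "map_coeffs \<phi> z = \<phi> \<circ> z"

definition base_ring :: "(nat \<Rightarrow> int) \<Rightarrow> (nat \<Rightarrow> int) set ring"
  where "base_ring h = UP \<Z> Quot (PIdl\<^bsub>UP \<Z>\<^esub> h)"

definition pow_ideal :: "(nat \<Rightarrow> int) \<Rightarrow> nat \<Rightarrow> nat \<Rightarrow> (nat \<Rightarrow> int) set set"
  where "pow_ideal h p e =
    PIdl\<^bsub>base_ring h\<^esub> (add_pow (base_ring h) (p ^ e) \<one>\<^bsub>base_ring h\<^esub>)"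

definition galois_ring :: "(nat \<Rightarrow> int) \<Rightarrow> nat \<Rightarrow> nat \<Rightarrow> (nat \<Rightarrow> int) set set ring"
  where "galois_ring h p e = base_ring h Quot pow_ideal h p e"

definition proj_mod :: "(nat \<Rightarrow> int) \<Rightarrow> nat \<Rightarrow> nat \<Rightarrow> (nat \<Rightarrow> int) set \<Rightarrow> (nat \<Rightarrow> int) set set"
  where "proj_mod h p e a = pow_ideal h p e +>\<^bsub>base_ring h\<^esub> a"

text \<open>For \<open>e \<ge> 1\<close>, the canonical map \<open>R\<^sub>e \<rightarrow> R\<^sub>1\<close> sends a coset \<open>p\<^sup>eR + a\<close> to the coset
  \<open>pR + (p\<^sup>eR + a) = pR + a\<close>.\<close>

definition red_mod :: "(nat \<Rightarrow> int) \<Rightarrow> nat \<Rightarrow> (nat \<Rightarrow> int) set set \<Rightarrow> (nat \<Rightarrow> int) set set"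
  where "red_mod h p C = pow_ideal h p 1 <+>\<^bsub>base_ring h\<^esub> C"

abbreviation residue_ring_mod :: "('a, 'm) ring_scheme \<Rightarrow> (nat \<Rightarrow> 'a) \<Rightarrow> (nat \<Rightarrow> 'a) set ring"
  where "residue_ring_mod S g \<equiv> UP S Quot (PIdl\<^bsub>UP S\<^esub> g)"

definition mult_map ::
    "('a, 'm) ring_scheme \<Rightarrow> (nat \<Rightarrow> 'a) \<Rightarrow> (nat \<Rightarrow> 'a) \<Rightarrow> (nat \<Rightarrow> 'a) set \<Rightarrow> (nat \<Rightarrow> 'a) set"
  where "mult_map S f g z =
    (PIdl\<^bsub>UP S\<^esub> g +>\<^bsub>UP S\<^esub> f) \<otimes>\<^bsub>residue_ring_mod S g\<^esub> z"

definition mult_system ::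
    "('a, 'm) ring_scheme \<Rightarrow> (nat \<Rightarrow> 'a) \<Rightarrow> (nat \<Rightarrow> 'a) \<Rightarrow> (nat \<Rightarrow> 'a) set dynsys"
  where "mult_system S f g = (carrier (residue_ring_mod S g), mult_map S f g)"

definition nilpotent_map :: "('a, 'm) ring_scheme \<Rightarrow> ('a \<Rightarrow> 'a) \<Rightarrow> bool"
  where "nilpotent_map Q \<Gamma> \<longleftrightarrow> (\<exists>n. \<forall>z\<in>carrier Q. (\<Gamma> ^^ n) z = \<zero>\<^bsub>Q\<^esub>)"

end

theory Submission
  imports Defs
begin

text \<open>
  Write \<open>S = R\<^sub>e[x]\<close> and \<open>T = R\<^sub>1[x]\<close>. Reduction of coefficients \<open>\<pi> : S \<rightarrow> T\<close> is a surjective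
  homomorphism whose kernel is \<open>pS\<close>, and \<open>p\<^sup>e = 0\<close> in \<open>S\<close>; so \<open>T\<close> is \<open>S\<close> modulo a nilpotent
  principal ideal. Everything happens in this abstract situation (locale
  \<open>nilpotent_thickening\<close>), where being comaximal, that is, satisfying a Bezout identity
  \<open>u a + v b = 1\<close>, is a property that can be tested modulo the nilpotent ideal
  (\<open>comaximal_lift\<close>).

  In \<open>T\<close>, \<open>f\<close> is comaximal with \<open>M\<^sub>1\<close>, hence so is every power of \<open>f\<close>; as \<open>M\<^sub>2\<close> divides some
  \<open>f\<^sup>n\<close>, the factors \<open>M\<^sub>1\<close> and \<open>M\<^sub>2\<close> are comaximal. Hensel's lemma then lifts the factorization
  \<open>m = M\<^sub>1 M\<^sub>2\<close> to \<open>m = m\<^sub>1 m\<^sub>2\<close> in \<open>S\<close> (\<open>hensel_factorization\<close>). The usual Newton step that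
  corrects both factors by multiples of the current error works with any lifts of the Bezout
  coefficients, so it is a statement about commutative rings and not about polynomials.

  The lifted factors are again comaximal, so by the Chinese remainder theorem the two projections
  identify \<open>S/(m)\<close> with \<open>S/(m\<^sub>2) \<times> S/(m\<^sub>1)\<close>. The projections are ring homomorphisms, so this
  bijection carries multiplication by \<open>f\<close> to the product of the multiplications by \<open>f\<close>. On
  \<open>S/(m\<^sub>1)\<close>, \<open>f\<close> is a unit because \<open>f\<close> and \<open>m\<^sub>1\<close> are comaximal. On \<open>S/(m\<^sub>2)\<close> it is nilpotent:
  \<open>f\<^sup>n\<close> lies in \<open>(m\<^sub>2)\<close> up to a multiple of \<open>p\<close>, so \<open>f\<^bsup>ne\<^esup>\<close> lies in \<open>(m\<^sub>2)\<close>.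
\<close>

section \<open>Comaximal elements and nilpotents\<close>

definition (in cring) comaximal :: "'a \<Rightarrow> 'a \<Rightarrow> bool"
  where "comaximal a b \<longleftrightarrow> (\<exists>u\<in>carrier R. \<exists>v\<in>carrier R. u \<otimes> a \<oplus> v \<otimes> b = \<one>)"

context cring
begin

lemma comaximal_iff_coprime_ideals:
  assumes "a \<in> carrier R" "b \<in> carrier R"
  shows "comaximal a b \<longleftrightarrow> coprime_ideals R (PIdl a) (PIdl b)"
proof
  have ab: "ideal (PIdl a) R" "ideal (PIdl b) R"
    using assms by (auto intro: cgenideal_ideal)
  interpret ideal "PIdl a <+>\<^bsub>R\<^esub> PIdl b" R
    using add_ideals[OF ab] .
  assume "comaximal a b"
  then have "\<one> \<in> PIdl a <+>\<^bsub>R\<^esub> PIdl b"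
    unfolding comaximal_def set_add_def' cgenideal_def by force
  then show "coprime_ideals R (PIdl a) (PIdl b)"
    unfolding coprime_ideals_def by (rule one_imp_carrier)
next
  assume "coprime_ideals R (PIdl a) (PIdl b)"
  then have "\<one> \<in> PIdl a <+>\<^bsub>R\<^esub> PIdl b"
    unfolding coprime_ideals_def by simp
  then show "comaximal a b"
    unfolding comaximal_def set_add_def' cgenideal_def by force
qed

lemma comaximal_sym:
  assumes "a \<in> carrier R" "b \<in> carrier R" "comaximal a b"
  shows "comaximal b a"
  using assms unfolding comaximal_def by (metis a_comm m_closed)

lemma comaximal_dvd:
  assumes ab: "comaximal (c \<otimes> a) b" and "a \<in> carrier R" "b \<in> carrier R" "c \<in> carrier R"
  shows "comaximal a b"
proof -
  from ab obtain u v where "u \<in> carrier R" "v \<in> carrier R" "u \<otimes> (c \<otimes> a) \<oplus> v \<otimes> b = \<one>"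
    unfolding comaximal_def by blast
  then show ?thesis
    unfolding comaximal_def using assms by (metis m_assoc m_closed)
qed

text \<open>Multiplying the Bezout identities of the pairs \<open>a\<^sup>n, b\<close> and \<open>a, b\<close> gives one for
  \<open>a\<^bsup>n+1\<^esup>, b\<close>.\<close>

lemma comaximal_pow:
  assumes ab: "comaximal a b" and a: "a \<in> carrier R" and b: "b \<in> carrier R"
  shows "comaximal (a [^] (n::nat)) b"
proof (induction n)
  case 0
  show ?case
    unfolding comaximal_def using b by (intro bexI[of _ \<one>] bexI[of _ \<zero>]) simp_all
next
  case (Suc n)
  obtain u v where uv: "u \<in> carrier R" "v \<in> carrier R" and 1: "u \<otimes> a \<oplus> v \<otimes> b = \<one>"
    using ab unfolding comaximal_def by blast
  obtain s t where st: "s \<in> carrier R" "t \<in> carrier R" and 2: "s \<otimes> a [^] n \<oplus> t \<otimes> b = \<one>"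
    using Suc unfolding comaximal_def by blast
  have an: "a [^] n \<in> carrier R"
    using a by simp
  have "(u \<otimes> s) \<otimes> (a [^] n \<otimes> a) \<oplus> (s \<otimes> a [^] n \<otimes> v \<oplus> t \<otimes> (u \<otimes> a \<oplus> v \<otimes> b)) \<otimes> b
      = (s \<otimes> a [^] n \<oplus> t \<otimes> b) \<otimes> (u \<otimes> a \<oplus> v \<otimes> b)"
    using a b uv st an by algebra
  then show ?case
    unfolding comaximal_def 1 2 nat_pow_Suc using a b uv st an
    by (intro bexI[of _ "u \<otimes> s"] bexI[of _ "s \<otimes> a [^] n \<otimes> v \<oplus> t \<otimes> \<one>"]) simp_all
qed

text \<open>The inverse is the geometric sum \<open>1 + y + \<dots> + y\<^bsup>n-1\<^esup>\<close>, built up term by term.\<close>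

lemma one_minus_nilpotent_Unit:
  assumes y: "y \<in> carrier R" and nil: "y [^] (n::nat) = \<zero>"
  shows "\<one> \<ominus> y \<in> Units R"
proof -
  have "\<exists>s\<in>carrier R. (\<one> \<ominus> y) \<otimes> s = \<one> \<ominus> y [^] k" for k :: nat
  proof (induction k)
    case 0
    show ?case
      using y by (auto intro!: bexI[of _ \<zero>] simp: minus_eq r_neg)
  next
    case (Suc k)
    then obtain s where s: "s \<in> carrier R" and eq: "(\<one> \<ominus> y) \<otimes> s = \<one> \<ominus> y [^] k"
      by blast
    have yk: "y [^] k \<in> carrier R"
      using y by simp
    have "(\<one> \<ominus> y) \<otimes> (s \<oplus> y [^] k) = (\<one> \<ominus> y) \<otimes> s \<oplus> (\<one> \<ominus> y) \<otimes> y [^] k"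
      using s y yk by algebra
    also have "\<dots> = \<one> \<ominus> y [^] k \<otimes> y"
      unfolding eq using y yk by algebra
    finally show ?case
      using s yk by auto
  qed
  from this[of n] obtain s where s: "s \<in> carrier R" "(\<one> \<ominus> y) \<otimes> s = \<one>"
    unfolding nil by (auto simp: minus_eq)
  moreover have "s \<otimes> (\<one> \<ominus> y) = \<one>"
    using s y by (simp add: m_comm)
  ultimately show ?thesis
    using y unfolding Units_def by blast
qed

end

section \<open>Multiplication on quotients and the Chinese remainder theorem\<close>

context cring
begin

lemma coset_eq_iff:
  assumes I: "ideal I R" and x: "x \<in> carrier R" and y: "y \<in> carrier R"
  shows "I +> x = I +> y \<longleftrightarrow> x \<ominus> y \<in> I"
  by (rule quotient_eq_iff_same_a_r_cos[OF I x y, symmetric])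

lemma coset_eq_ideal_iff:
  assumes "ideal I R" and "x \<in> carrier R"
  shows "I +> x = I \<longleftrightarrow> x \<in> I"
  using a_rcos_zero[OF assms(1)] ideal.rcos_const_imp_mem[OF assms] by metis

text \<open>The canonical map \<open>R/I \<rightarrow> R/J\<close> for \<open>I \<subseteq> J\<close> can be written without choosing
  representatives, as \<open>C \<mapsto> J + C\<close>, because \<open>J\<close> absorbs the summand \<open>I\<close> of each coset.\<close>

lemma set_add_coset_absorb:
  assumes I: "ideal I R" and J: "ideal J R" and IJ: "I \<subseteq> J" and x: "x \<in> carrier R"
  shows "J <+>\<^bsub>R\<^esub> (I +> x) = J +> x"
proof -
  interpret I: ideal I R by fact
  interpret J: ideal J R by fact
  show ?thesis
  proof (intro equalityI subsetI)
    fix z assume "z \<in> J <+>\<^bsub>R\<^esub> (I +> x)"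
    then obtain j i where "j \<in> J" "i \<in> I" "z = j \<oplus> (i \<oplus> x)"
      unfolding set_add_def' a_r_coset_def' by blast
    moreover from this have "z = (j \<oplus> i) \<oplus> x"
      using x by (simp add: a_assoc)
    ultimately show "z \<in> J +> x"
      unfolding a_r_coset_def' using IJ by blast
  next
    fix z assume "z \<in> J +> x"
    then obtain j where "j \<in> J" "z = j \<oplus> x"
      unfolding a_r_coset_def' by blast
    moreover have "x \<in> I +> x"
      using x by (rule I.a_rcos_self)
    ultimately show "z \<in> J <+>\<^bsub>R\<^esub> (I +> x)"
      unfolding set_add_def' by blast
  qed
qed

lemma carrier_Quot: "carrier (R Quot I) = (\<lambda>x. I +> x) ` carrier R"
  by (auto simp: FactRing_simps)

lemma zero_Quot: "\<zero>\<^bsub>R Quot I\<^esub> = I"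
  by (simp add: FactRing_def)

lemma mult_coset:
  assumes "ideal I R" "x \<in> carrier R" "y \<in> carrier R"
  shows "(I +> x) \<otimes>\<^bsub>R Quot I\<^esub> (I +> y) = I +> (x \<otimes> y)"
  using ideal.rcoset_mult_add[OF assms] by (simp add: FactRing_def)

lemma Quot_projection_ring_hom:
  assumes I: "ideal I R" and J: "ideal J R" and IJ: "I \<subseteq> J"
  shows "(\<lambda>C. J <+>\<^bsub>R\<^esub> C) \<in> ring_hom (R Quot I) (R Quot J)"
proof -
  interpret rI: ring_hom_ring R "R Quot I" "(+>) I" using I by (rule ideal.rcos_ring_hom_ring)
  interpret rJ: ring_hom_ring R "R Quot J" "(+>) J" using J by (rule ideal.rcos_ring_hom_ring)
  note absorb = set_add_coset_absorb[OF I J IJ]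
  show ?thesis
  proof (rule ring_hom_memI)
    fix C assume "C \<in> carrier (R Quot I)"
    then show "J <+>\<^bsub>R\<^esub> C \<in> carrier (R Quot J)"
      by (auto simp: carrier_Quot absorb)
  next
    fix C D assume "C \<in> carrier (R Quot I)" "D \<in> carrier (R Quot I)"
    then obtain x y where xy: "x \<in> carrier R" "y \<in> carrier R" and CD: "C = I +> x" "D = I +> y"
      by (auto simp: carrier_Quot)
    show "J <+>\<^bsub>R\<^esub> (C \<otimes>\<^bsub>R Quot I\<^esub> D) = (J <+>\<^bsub>R\<^esub> C) \<otimes>\<^bsub>R Quot J\<^esub> (J <+>\<^bsub>R\<^esub> D)"
      unfolding CD using xy by (simp add: absorb flip: rI.hom_mult rJ.hom_mult)
    show "J <+>\<^bsub>R\<^esub> (C \<oplus>\<^bsub>R Quot I\<^esub> D) = (J <+>\<^bsub>R\<^esub> C) \<oplus>\<^bsub>R Quot J\<^esub> (J <+>\<^bsub>R\<^esub> D)"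
      unfolding CD using xy by (simp add: absorb flip: rI.hom_add rJ.hom_add)
  next
    show "J <+>\<^bsub>R\<^esub> \<one>\<^bsub>R Quot I\<^esub> = \<one>\<^bsub>R Quot J\<^esub>"
      by (simp add: absorb flip: rI.hom_one rJ.hom_one)
  qed
qed

lemma cgenideal_mult_subset:
  assumes "a \<in> carrier R" and "b \<in> carrier R"
  shows "PIdl (a \<otimes> b) \<subseteq> PIdl a" and "PIdl (a \<otimes> b) \<subseteq> PIdl b"
proof -
  show "PIdl (a \<otimes> b) \<subseteq> PIdl b"
    using assms unfolding cgenideal_def by (auto intro: m_closed simp flip: m_assoc)
  have "x \<otimes> (a \<otimes> b) = (x \<otimes> b) \<otimes> a" if "x \<in> carrier R" for x
    using assms that by (simp add: m_ac)
  then show "PIdl (a \<otimes> b) \<subseteq> PIdl a"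
    using assms unfolding cgenideal_def by blast
qed

lemma cgenideal_pow_subset:
  assumes a: "a \<in> carrier R" and e: "1 \<le> (e::nat)"
  shows "PIdl (a [^] e) \<subseteq> PIdl a"
proof -
  obtain k where "e = Suc k"
    using e by (cases e) auto
  then show ?thesis
    using a by (simp add: cgenideal_mult_subset)
qed

text \<open>The Bezout identity serves twice. It shows that \<open>(a) \<inter> (b) = (ab)\<close>, which gives
  injectivity, and it solves a pair of congruences explicitly, which gives surjectivity.\<close>

lemma chinese_remainder_bij:
  assumes a: "a \<in> carrier R" and b: "b \<in> carrier R" and ab: "comaximal a b"
  shows "bij_betw (\<lambda>C. (PIdl b <+>\<^bsub>R\<^esub> C, PIdl a <+>\<^bsub>R\<^esub> C)) (carrier (R Quot PIdl (a \<otimes> b)))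
    (carrier (R Quot PIdl b) \<times> carrier (R Quot PIdl a))"
proof -
  let ?\<phi> = "\<lambda>C. (PIdl b <+>\<^bsub>R\<^esub> C, PIdl a <+>\<^bsub>R\<^esub> C)"
  have I: "ideal (PIdl (a \<otimes> b)) R" and Ia: "ideal (PIdl a) R" and Ib: "ideal (PIdl b) R"
    using a b by (auto intro: cgenideal_ideal)
  have sub: "PIdl (a \<otimes> b) \<subseteq> PIdl a" "PIdl (a \<otimes> b) \<subseteq> PIdl b"
    using a b by (auto dest: cgenideal_mult_subset)
  have \<phi>: "?\<phi> (PIdl (a \<otimes> b) +> x) = (PIdl b +> x, PIdl a +> x)" if "x \<in> carrier R" for x
    using that sub by (simp add: set_add_coset_absorb I Ia Ib)
  obtain u v where uv: "u \<in> carrier R" "v \<in> carrier R" and 1: "u \<otimes> a \<oplus> v \<otimes> b = \<one>"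
    using ab unfolding comaximal_def by blast
  have inter: "z \<in> PIdl (a \<otimes> b)" if z: "z \<in> PIdl a" "z \<in> PIdl b" for z
  proof -
    obtain s t where st: "s \<in> carrier R" "t \<in> carrier R" and zst: "z = s \<otimes> a" "z = t \<otimes> b"
      using z unfolding cgenideal_def by blast
    then have zc: "z \<in> carrier R"
      using a by simp
    have "z = (u \<otimes> a \<oplus> v \<otimes> b) \<otimes> z"
      unfolding 1 using zc by simp
    also have "\<dots> = u \<otimes> a \<otimes> z \<oplus> v \<otimes> b \<otimes> z"
      using uv a b zc by algebra
    also have "\<dots> = u \<otimes> a \<otimes> (t \<otimes> b) \<oplus> v \<otimes> b \<otimes> (s \<otimes> a)"
      using zst by simp
    also have "\<dots> = (u \<otimes> t \<oplus> v \<otimes> s) \<otimes> (a \<otimes> b)"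
      using uv a b st by algebra
    finally show ?thesis
      unfolding cgenideal_def using uv st by blast
  qed
  show ?thesis
  proof (rule bij_betw_imageI)
    show "inj_on ?\<phi> (carrier (R Quot PIdl (a \<otimes> b)))"
    proof (rule inj_onI)
      fix C D assume "C \<in> carrier (R Quot PIdl (a \<otimes> b))" "D \<in> carrier (R Quot PIdl (a \<otimes> b))"
        and eq: "?\<phi> C = ?\<phi> D"
      then obtain x y where xy: "x \<in> carrier R" "y \<in> carrier R"
        and CD: "C = PIdl (a \<otimes> b) +> x" "D = PIdl (a \<otimes> b) +> y"
        by (auto simp: carrier_Quot)
      have "x \<ominus> y \<in> PIdl a" "x \<ominus> y \<in> PIdl b"
        using eq xy unfolding CD \<phi>[OF xy(1)] \<phi>[OF xy(2)]
        by (auto simp: coset_eq_iff Ia Ib)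
      then show "C = D"
        unfolding CD using xy inter by (simp add: coset_eq_iff I)
    qed
    show "?\<phi> ` carrier (R Quot PIdl (a \<otimes> b)) = carrier (R Quot PIdl b) \<times> carrier (R Quot PIdl a)"
    proof (intro equalityI subsetI)
      fix z assume "z \<in> ?\<phi> ` carrier (R Quot PIdl (a \<otimes> b))"
      then show "z \<in> carrier (R Quot PIdl b) \<times> carrier (R Quot PIdl a)"
        using \<phi> by (auto simp: carrier_Quot)
    next
      fix z assume "z \<in> carrier (R Quot PIdl b) \<times> carrier (R Quot PIdl a)"
      then obtain y x where xy: "x \<in> carrier R" "y \<in> carrier R"
        and z: "z = (PIdl b +> y, PIdl a +> x)"
        by (auto simp: carrier_Quot)
      \<comment> \<open>\<open>u a\<close> is \<open>1\<close> modulo \<open>b\<close> and \<open>0\<close> modulo \<open>a\<close>, and \<open>v b\<close> the other way round.\<close>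
      define w where "w = u \<otimes> a \<otimes> y \<oplus> v \<otimes> b \<otimes> x"
      have w: "w \<in> carrier R"
        unfolding w_def using uv a b xy by simp
      have "w \<ominus> y = w \<ominus> (u \<otimes> a \<oplus> v \<otimes> b) \<otimes> y"
        unfolding 1 using xy by simp
      also have "\<dots> = (v \<otimes> (x \<ominus> y)) \<otimes> b"
        unfolding w_def using uv a b xy by algebra
      finally have wy: "w \<ominus> y \<in> PIdl b"
        unfolding cgenideal_def using uv xy by blast
      have "w \<ominus> x = w \<ominus> (u \<otimes> a \<oplus> v \<otimes> b) \<otimes> x"
        unfolding 1 using xy by simp
      also have "\<dots> = (u \<otimes> (y \<ominus> x)) \<otimes> a"
        unfolding w_def using uv a b xy by algebra
      finally have wx: "w \<ominus> x \<in> PIdl a"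
        unfolding cgenideal_def using uv xy by blast
      have "z = ?\<phi> (PIdl (a \<otimes> b) +> w)"
        unfolding \<phi>[OF w] z using wx wy w xy coset_eq_iff[OF Ia w xy(1)] coset_eq_iff[OF Ib w xy(2)] by simp
      then show "z \<in> ?\<phi> ` carrier (R Quot PIdl (a \<otimes> b))"
        using w by (auto simp: carrier_Quot)
    qed
  qed
qed

text \<open>The Bezout coefficient of \<open>f\<close> is an inverse of \<open>f\<close> modulo \<open>g\<close>, so multiplication by
  it is the inverse map.\<close>

lemma mult_comaximal_bij:
  assumes f: "f \<in> carrier R" and g: "g \<in> carrier R" and fg: "comaximal f g"
  shows "bij_betw (\<lambda>z. (PIdl g +> f) \<otimes>\<^bsub>R Quot PIdl g\<^esub> z)
    (carrier (R Quot PIdl g)) (carrier (R Quot PIdl g))"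
proof -
  have I: "ideal (PIdl g) R"
    using g by (rule cgenideal_ideal)
  obtain u v where uv: "u \<in> carrier R" "v \<in> carrier R" and 1: "u \<otimes> f \<oplus> v \<otimes> g = \<one>"
    using fg unfolding comaximal_def by blast
  have inverse: "PIdl g +> (u \<otimes> (f \<otimes> x)) = PIdl g +> x" if x: "x \<in> carrier R" for x
  proof -
    have "u \<otimes> (f \<otimes> x) \<ominus> x = u \<otimes> (f \<otimes> x) \<ominus> (u \<otimes> f \<oplus> v \<otimes> g) \<otimes> x"
      unfolding 1 using x by simp
    also have "\<dots> = (\<ominus> (v \<otimes> x)) \<otimes> g"
      using uv f g x by algebra
    finally have "u \<otimes> (f \<otimes> x) \<ominus> x \<in> PIdl g"
      unfolding cgenideal_def using uv x by blast
    then show ?thesis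
      using x uv f by (simp add: coset_eq_iff I)
  qed
  show ?thesis
  proof (rule bij_betw_byWitness[where f' = "\<lambda>z. (PIdl g +> u) \<otimes>\<^bsub>R Quot PIdl g\<^esub> z"])
    show "\<forall>z\<in>carrier (R Quot PIdl g). (PIdl g +> u) \<otimes>\<^bsub>R Quot PIdl g\<^esub> ((PIdl g +> f) \<otimes>\<^bsub>R Quot PIdl g\<^esub> z) = z"
      using uv f inverse by (auto simp: carrier_Quot mult_coset I)
    show "\<forall>z\<in>carrier (R Quot PIdl g). (PIdl g +> f) \<otimes>\<^bsub>R Quot PIdl g\<^esub> ((PIdl g +> u) \<otimes>\<^bsub>R Quot PIdl g\<^esub> z) = z"
      using uv f inverse by (auto simp: carrier_Quot mult_coset I m_lcomm)
  qed (use uv f in \<open>auto simp: carrier_Quot mult_coset I\<close>)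
qed

lemma mult_funpow_eq_zero:
  assumes f: "f \<in> carrier R" and g: "g \<in> carrier R" and fn: "f [^] (n::nat) \<in> PIdl g"
    and z: "z \<in> carrier (R Quot PIdl g)"
  shows "((\<lambda>z. (PIdl g +> f) \<otimes>\<^bsub>R Quot PIdl g\<^esub> z) ^^ n) z = \<zero>\<^bsub>R Quot PIdl g\<^esub>"
proof -
  have I: "ideal (PIdl g) R"
    using g by (rule cgenideal_ideal)
  obtain x where x: "x \<in> carrier R" and zx: "z = PIdl g +> x"
    using z by (auto simp: carrier_Quot)
  have "((\<lambda>z. (PIdl g +> f) \<otimes>\<^bsub>R Quot PIdl g\<^esub> z) ^^ k) z = PIdl g +> (f [^] k \<otimes> x)" for k
    by (induction k) (use f x in \<open>simp_all add: zx mult_coset I nat_pow_mult m_ac\<close>)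
  moreover have "f [^] n \<otimes> x \<in> PIdl g"
    using I fn x by (rule ideal.I_r_closed)
  ultimately show ?thesis
    using f x by (simp add: coset_eq_ideal_iff[OF I] FactRing_def)
qed

end

section \<open>Lifting along a nilpotent principal kernel\<close>

text \<open>The model case is the reduction \<open>R/(a\<^sup>n) \<rightarrow> R/(a)\<close>, with \<open>q\<close> the class of \<open>a\<close>. Naming a
  generator of the kernel lets an error term in \<open>(q\<^sup>i)\<close> be written as \<open>q\<^sup>i r\<close>, so that
  successive approximation is plain algebra with the cofactor \<open>r\<close>.\<close>

locale nilpotent_thickening = ring_hom_cring S T \<pi> for S (structure) and T and \<pi> +
  fixes q and n :: nat
  assumes surj: "\<pi> ` carrier S = carrier T"
    and q_closed [simp, intro]: "q \<in> carrier S"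
    and q_ker [simp]: "\<pi> q = \<zero>\<^bsub>T\<^esub>"
    and ker: "\<And>x. x \<in> carrier S \<Longrightarrow> \<pi> x = \<zero>\<^bsub>T\<^esub> \<Longrightarrow> \<exists>y\<in>carrier S. x = q \<otimes> y"
    and q_nilpotent: "q [^] n = \<zero>"
begin

lemma lift:
  assumes "y \<in> carrier T"
  obtains x where "x \<in> carrier S" "\<pi> x = y"
  using assms that unfolding surj[symmetric] by blast

lemma eq_modulo_kernel:
  assumes x: "x \<in> carrier S" and y: "y \<in> carrier S" and eq: "\<pi> x = \<pi> y"
  obtains w where "w \<in> carrier S" "x = y \<oplus> q \<otimes> w"
proof -
  have "\<pi> (x \<ominus> y) = \<zero>\<^bsub>T\<^esub>"
    using x y eq by (simp add: R.minus_eq S.r_neg)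
  then obtain w where w: "w \<in> carrier S" "x \<ominus> y = q \<otimes> w"
    using ker[of "x \<ominus> y"] x y by auto
  have "x = y \<oplus> (x \<ominus> y)"
    using x y by algebra
  with w that show ?thesis
    by simp
qed

text \<open>Lifting a Bezout identity leaves \<open>u a + v b = 1 - q w\<close>. Since \<open>q w\<close> is nilpotent, the
  right-hand side is a unit, and dividing by it repairs the identity.\<close>

lemma comaximal_lift:
  assumes a: "a \<in> carrier S" and b: "b \<in> carrier S" and ab: "S.comaximal (\<pi> a) (\<pi> b)"
  shows "R.comaximal a b"
proof -
  obtain u' v' where "u' \<in> carrier T" "v' \<in> carrier T"
    and 1: "u' \<otimes>\<^bsub>T\<^esub> \<pi> a \<oplus>\<^bsub>T\<^esub> v' \<otimes>\<^bsub>T\<^esub> \<pi> b = \<one>\<^bsub>T\<^esub>"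
    using ab unfolding S.comaximal_def by blast
  then obtain u v where uv: "u \<in> carrier S" "v \<in> carrier S" "\<pi> u = u'" "\<pi> v = v'"
    using lift by metis
  have "\<pi> \<one> = \<pi> (u \<otimes> a \<oplus> v \<otimes> b)"
    using uv a b 1 by simp
  then obtain w where w: "w \<in> carrier S" and "\<one> = (u \<otimes> a \<oplus> v \<otimes> b) \<oplus> q \<otimes> w"
    using eq_modulo_kernel[of \<one> "u \<otimes> a \<oplus> v \<otimes> b"] uv a b by auto
  then have eq: "u \<otimes> a \<oplus> v \<otimes> b = \<one> \<ominus> q \<otimes> w"
    using uv a b w by (metis R.add.m_comm R.add.inv_solve_right' R.minus_eq R.m_closed R.a_closed R.one_closed q_closed)
  have "(q \<otimes> w) [^] n = \<zero>"
    using w by (simp add: R.nat_pow_distrib q_nilpotent)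
  then have "\<one> \<ominus> q \<otimes> w \<in> Units S"
    using w by (intro R.one_minus_nilpotent_Unit) auto
  then obtain s where s: "s \<in> carrier S" "s \<otimes> (u \<otimes> a \<oplus> v \<otimes> b) = \<one>"
    unfolding eq Units_def by blast
  have "(s \<otimes> u) \<otimes> a \<oplus> (s \<otimes> v) \<otimes> b = s \<otimes> (u \<otimes> a \<oplus> v \<otimes> b)"
    using s uv a b by algebra
  then show ?thesis
    unfolding R.comaximal_def using s uv by (metis R.m_closed)
qed

text \<open>Hensel's lemma. Suppose \<open>a = g k + q\<^bsup>i+1\<^esup> r\<close> and \<open>u g + v k = 1 + q w\<close>. Replacing \<open>g\<close> by
  \<open>g + q\<^bsup>i+1\<^esup> r v\<close> and \<open>k\<close> by \<open>k + q\<^bsup>i+1\<^esup> r u\<close> adds \<open>q\<^bsup>i+1\<^esup> r (1 + q w)\<close> to the product, up to a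
  multiple of \<open>q\<^bsup>2i+2\<^esup>\<close>. The error is thereby cancelled modulo \<open>q\<^bsup>i+2\<^esup>\<close>, and both factors keep
  their images under \<open>\<pi>\<close>.\<close>

lemma hensel_factorization:
  assumes a: "a \<in> carrier S" and b: "b \<in> carrier T" and c: "c \<in> carrier T"
    and bc: "S.comaximal b c" and factor: "\<pi> a = b \<otimes>\<^bsub>T\<^esub> c"
  obtains g k where "g \<in> carrier S" "k \<in> carrier S" "\<pi> g = b" "\<pi> k = c" "a = g \<otimes> k"
proof -
  obtain u' v' where uv': "u' \<in> carrier T" "v' \<in> carrier T"
    and 1: "u' \<otimes>\<^bsub>T\<^esub> b \<oplus>\<^bsub>T\<^esub> v' \<otimes>\<^bsub>T\<^esub> c = \<one>\<^bsub>T\<^esub>"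
    using bc unfolding S.comaximal_def by blast
  then obtain u v where uv: "u \<in> carrier S" "v \<in> carrier S" "\<pi> u = u'" "\<pi> v = v'"
    using lift by metis
  have "\<exists>g\<in>carrier S. \<exists>k\<in>carrier S. \<exists>r\<in>carrier S.
      \<pi> g = b \<and> \<pi> k = c \<and> a = g \<otimes> k \<oplus> q [^] i \<otimes> q \<otimes> r" for i :: nat
  proof (induction i)
    case 0
    obtain g k where gk: "g \<in> carrier S" "k \<in> carrier S" "\<pi> g = b" "\<pi> k = c"
      using b c lift by metis
    then have "\<pi> a = \<pi> (g \<otimes> k)"
      using factor by simp
    then obtain r where "r \<in> carrier S" "a = g \<otimes> k \<oplus> q \<otimes> r"
      using eq_modulo_kernel[of a "g \<otimes> k"] a gk by auto
    then show ?case
      using gk by auto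
  next
    case (Suc i)
    then obtain g k r where gk: "g \<in> carrier S" "k \<in> carrier S" "\<pi> g = b" "\<pi> k = c"
      and r: "r \<in> carrier S" and eq: "a = g \<otimes> k \<oplus> q [^] i \<otimes> q \<otimes> r"
      by blast
    have "\<pi> (u \<otimes> g \<oplus> v \<otimes> k) = \<pi> \<one>"
      using uv gk 1 by simp
    then obtain w where w: "w \<in> carrier S" and bezout: "u \<otimes> g \<oplus> v \<otimes> k = \<one> \<oplus> q \<otimes> w"
      using eq_modulo_kernel[of "u \<otimes> g \<oplus> v \<otimes> k" \<one>] uv gk by auto
    define t where "t = q [^] i"
    have t: "t \<in> carrier S"
      unfolding t_def by simp
    \<comment> \<open>Here \<open>- r'\<close> collects the surplus \<open>r w\<close> of the approximate Bezout identity and the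
      product of the two corrections, after removing the factor \<open>t q q = q\<^bsup>i+2\<^esup>\<close>.\<close>
    define g' k' r' where "g' = g \<oplus> t \<otimes> q \<otimes> r \<otimes> v" and "k' = k \<oplus> t \<otimes> q \<otimes> r \<otimes> u"
      and "r' = \<ominus> (r \<otimes> w \<oplus> t \<otimes> r \<otimes> r \<otimes> u \<otimes> v)"
    have closed: "g' \<in> carrier S" "k' \<in> carrier S" "r' \<in> carrier S"
      unfolding g'_def k'_def r'_def using gk uv r w t by auto
    have "g' \<otimes> k' = g \<otimes> k \<oplus> t \<otimes> q \<otimes> r \<otimes> (u \<otimes> g \<oplus> v \<otimes> k)
        \<oplus> t \<otimes> q \<otimes> q \<otimes> (t \<otimes> r \<otimes> r \<otimes> u \<otimes> v)"
      unfolding g'_def k'_def using gk(1,2) uv(1,2) r w t q_closed by algebra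
    then have "g' \<otimes> k' \<oplus> t \<otimes> q \<otimes> q \<otimes> r' = g \<otimes> k \<oplus> t \<otimes> q \<otimes> r \<otimes> (\<one> \<oplus> q \<otimes> w)
        \<oplus> t \<otimes> q \<otimes> q \<otimes> (t \<otimes> r \<otimes> r \<otimes> u \<otimes> v) \<oplus> t \<otimes> q \<otimes> q \<otimes> r'"
      unfolding bezout by simp
    also have "\<dots> = g \<otimes> k \<oplus> t \<otimes> q \<otimes> r"
      unfolding r'_def using gk(1,2) uv(1,2) r w t q_closed by algebra
    finally have "a = g' \<otimes> k' \<oplus> q [^] Suc i \<otimes> q \<otimes> r'"
      unfolding eq t_def by simp
    moreover have "\<pi> g' = b" "\<pi> k' = c"
      unfolding g'_def k'_def using gk uv uv' b c r t by simp_all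
    ultimately show ?case
      using closed by blast
  qed
  \<comment> \<open>At stage \<open>n\<close> the error term contains \<open>q\<^sup>n = 0\<close>.\<close>
  from this[of n] show thesis
    using that by (auto simp: q_nilpotent)
qed

text \<open>Modulo \<open>g\<close>, \<open>x\<close> is a multiple of \<open>q\<close>, so \<open>x\<^sup>k\<close> is a multiple of \<open>q\<^sup>k\<close>.\<close>

lemma pow_mem_PIdl_lift:
  assumes x: "x \<in> carrier S" and g: "g \<in> carrier S" and xg: "\<pi> x \<in> PIdl\<^bsub>T\<^esub> (\<pi> g)"
  shows "x [^] n \<in> PIdl\<^bsub>S\<^esub> g"
proof -
  obtain y' where "y' \<in> carrier T" and eq: "\<pi> x = y' \<otimes>\<^bsub>T\<^esub> \<pi> g"
    using xg unfolding cgenideal_def by blast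
  then obtain y where y: "y \<in> carrier S" "\<pi> y = y'"
    using lift by metis
  then have "\<pi> x = \<pi> (y \<otimes> g)"
    using eq g by simp
  then obtain w where w: "w \<in> carrier S" and xw: "x = y \<otimes> g \<oplus> q \<otimes> w"
    using eq_modulo_kernel[of x "y \<otimes> g"] x y g by auto
  have "\<exists>s\<in>carrier S. \<exists>r\<in>carrier S. x [^] k = s \<otimes> g \<oplus> q [^] k \<otimes> r" for k :: nat
  proof (induction k)
    case 0
    show ?case
      using g by (intro bexI[of _ \<zero>] bexI[of _ \<one>]) auto
  next
    case (Suc k)
    then obtain s r where sr: "s \<in> carrier S" "r \<in> carrier S"
      and eq: "x [^] k = s \<otimes> g \<oplus> q [^] k \<otimes> r"
      by blast
    define t where "t = q [^] k"
    have t: "t \<in> carrier S"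
      unfolding t_def by simp
    have "x [^] Suc k = (s \<otimes> g \<oplus> t \<otimes> r) \<otimes> x"
      unfolding t_def by (simp add: eq)
    also have "\<dots> = (s \<otimes> g \<oplus> t \<otimes> r) \<otimes> (y \<otimes> g \<oplus> q \<otimes> w)"
      using xw by simp
    also have "\<dots> = (s \<otimes> (y \<otimes> g \<oplus> q \<otimes> w) \<oplus> t \<otimes> r \<otimes> y) \<otimes> g \<oplus> t \<otimes> q \<otimes> (r \<otimes> w)"
      using sr y(1) w g t q_closed by algebra
    finally have "x [^] Suc k = (s \<otimes> (y \<otimes> g \<oplus> q \<otimes> w) \<oplus> t \<otimes> r \<otimes> y) \<otimes> g
        \<oplus> q [^] Suc k \<otimes> (r \<otimes> w)"
      unfolding t_def by simp
    moreover have "s \<otimes> (y \<otimes> g \<oplus> q \<otimes> w) \<oplus> t \<otimes> r \<otimes> y \<in> carrier S" "r \<otimes> w \<in> carrier S"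
      using sr y w g t by auto
    ultimately show ?case
      by blast
  qed
  from this[of n] show ?thesis
    using g by (auto simp: q_nilpotent cgenideal_def)
qed

end

section \<open>Nilpotent thickenings of polynomial rings and of quotients\<close>

lemma carrier_UP_iff: "z \<in> carrier (UP A) \<longleftrightarrow> (\<forall>i. z i \<in> carrier A) \<and> (\<exists>n. bound \<zero>\<^bsub>A\<^esub> n z)"
  by (auto simp: UP_def up_def)

lemma smult_UP_eq:
  "a \<in> carrier A \<Longrightarrow> z \<in> carrier (UP A) \<Longrightarrow> a \<odot>\<^bsub>UP A\<^esub> z = (\<lambda>i. a \<otimes>\<^bsub>A\<^esub> z i)"
  by (simp add: UP_def)

lemma map_coeffs_ring_hom:
  assumes "ring_hom_cring A B \<phi>"
  shows "map_coeffs \<phi> \<in> ring_hom (UP A) (UP B)"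
proof -
  interpret ring_hom_cring A B \<phi> by fact
  have closed: "map_coeffs \<phi> z \<in> up B" if z: "z \<in> up A" for z
  proof -
    obtain n where "bound \<zero>\<^bsub>A\<^esub> n z"
      using R.bound_upD[OF z] by blast
    then have "bound \<zero>\<^bsub>B\<^esub> n (map_coeffs \<phi> z)"
      by (auto simp: bound_def map_coeffs_def)
    then show ?thesis
      using z mem_upD[OF z] by (auto simp: up_def map_coeffs_def)
  qed
  show ?thesis
  proof (rule ring_hom_memI)
    fix x y assume "x \<in> carrier (UP A)" "y \<in> carrier (UP A)"
    then have xy: "x \<in> up A" "y \<in> up A"
      by (auto simp: UP_def)
    then have coeffs: "x i \<in> carrier A" "y i \<in> carrier A" for i
      by (auto simp: up_def)
    show "map_coeffs \<phi> (x \<otimes>\<^bsub>UP A\<^esub> y) = map_coeffs \<phi> x \<otimes>\<^bsub>UP B\<^esub> map_coeffs \<phi> y"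
      using xy closed coeffs by (simp add: UP_def) (simp add: map_coeffs_def fun_eq_iff Pi_def o_def)
    show "map_coeffs \<phi> (x \<oplus>\<^bsub>UP A\<^esub> y) = map_coeffs \<phi> x \<oplus>\<^bsub>UP B\<^esub> map_coeffs \<phi> y"
      using xy closed coeffs by (simp add: UP_def) (simp add: map_coeffs_def fun_eq_iff)
  next
    show "map_coeffs \<phi> \<one>\<^bsub>UP A\<^esub> = \<one>\<^bsub>UP B\<^esub>"
      by (auto simp: UP_def map_coeffs_def)
  qed (use closed in \<open>auto simp: UP_def\<close>)
qed

text \<open>Coefficientwise choice. A zero coefficient must be lifted to zero, since otherwise the
  chosen sequence could fail to have finite support.\<close>

lemma lift_coeffs:
  assumes "ring A" and P0: "P \<zero>\<^bsub>B\<^esub> \<zero>\<^bsub>A\<^esub>" and z: "z \<in> carrier (UP B)"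
    and lift: "\<And>i. \<exists>x\<in>carrier A. P (z i) x"
  obtains w where "w \<in> carrier (UP A)" "\<And>i. P (z i) (w i)"
proof -
  interpret ring A by fact
  define w where "w i = (if z i = \<zero>\<^bsub>B\<^esub> then \<zero>\<^bsub>A\<^esub> else SOME x. x \<in> carrier A \<and> P (z i) x)" for i
  have w: "w i \<in> carrier A \<and> P (z i) (w i)" for i
    unfolding w_def using P0 someI_ex[of "\<lambda>x. x \<in> carrier A \<and> P (z i) x"] lift[of i] by auto
  have "bound \<zero>\<^bsub>A\<^esub> n w" if "bound \<zero>\<^bsub>B\<^esub> n z" for n
    using that by (auto simp: bound_def w_def)
  then have "w \<in> carrier (UP A)"
    using z w by (auto simp: carrier_UP_iff)
  then show ?thesis
    using w that by blast
qed

text \<open>A polynomial reduces to zero iff each of its coefficients is a multiple of \<open>q\<close>, and then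
  the cofactors of the coefficients form a polynomial cofactor.\<close>

lemma nilpotent_thickening_UP:
  assumes "nilpotent_thickening A B \<phi> q n"
  shows "nilpotent_thickening (UP A) (UP B) (map_coeffs \<phi>) (up_ring.monom (UP A) q 0) n"
proof -
  interpret nilpotent_thickening A B \<phi> q n by fact
  interpret UA: UP_cring A "UP A" by unfold_locales simp
  interpret UB: UP_cring B "UP B" by unfold_locales simp
  have hom: "map_coeffs \<phi> \<in> ring_hom (UP A) (UP B)"
    by (rule map_coeffs_ring_hom) unfold_locales
  interpret U: ring_hom_cring "UP A" "UP B" "map_coeffs \<phi>"
    by unfold_locales (rule hom)
  interpret const: ring_hom_cring A "UP A" "\<lambda>a. up_ring.monom (UP A) a 0"
    by unfold_locales (rule UA.const_ring_hom)
  have monom_q: "up_ring.monom (UP A) q 0 = (\<lambda>i. if i = 0 then q else \<zero>\<^bsub>A\<^esub>)"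
    by (simp add: UP_def)
  show ?thesis
  proof unfold_locales
    show "map_coeffs \<phi> ` carrier (UP A) = carrier (UP B)"
    proof (intro equalityI subsetI)
      fix z assume z: "z \<in> carrier (UP B)"
      obtain w where w: "w \<in> carrier (UP A)" "\<And>i. \<phi> (w i) = z i"
      proof (rule lift_coeffs[of A "\<lambda>y x. \<phi> x = y" B z, OF R.ring_axioms _ z])
        show "\<phi> \<zero>\<^bsub>A\<^esub> = \<zero>\<^bsub>B\<^esub>"
          by simp
        show "\<exists>x\<in>carrier A. \<phi> x = z i" for i
          using z lift[of "z i"] unfolding carrier_UP_iff by metis
      qed (rule that)
      then have "z = map_coeffs \<phi> w"
        by (auto simp: map_coeffs_def)
      then show "z \<in> map_coeffs \<phi> ` carrier (UP A)"
        using w by blast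
    qed auto
    show "up_ring.monom (UP A) q 0 \<in> carrier (UP A)"
      by simp
    show "map_coeffs \<phi> (up_ring.monom (UP A) q 0) = \<zero>\<^bsub>UP B\<^esub>"
      unfolding monom_q by (auto simp: map_coeffs_def UP_def)
    show "up_ring.monom (UP A) q 0 [^]\<^bsub>UP A\<^esub> n = \<zero>\<^bsub>UP A\<^esub>"
      using const.hom_pow[of q n] q_nilpotent by simp
    fix x assume x: "x \<in> carrier (UP A)" and "map_coeffs \<phi> x = \<zero>\<^bsub>UP B\<^esub>"
    then have x0: "\<phi> (x i) = \<zero>\<^bsub>B\<^esub>" for i
      by (auto simp: map_coeffs_def UP_def fun_eq_iff)
    obtain y where y: "y \<in> carrier (UP A)" "\<And>i. x i = q \<otimes>\<^bsub>A\<^esub> y i"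
    proof (rule lift_coeffs[of A "\<lambda>x y. x = q \<otimes>\<^bsub>A\<^esub> y" A x, OF R.ring_axioms _ x])
      show "\<zero>\<^bsub>A\<^esub> = q \<otimes>\<^bsub>A\<^esub> \<zero>\<^bsub>A\<^esub>"
        by simp
      show "\<exists>y\<in>carrier A. x i = q \<otimes>\<^bsub>A\<^esub> y" for i
        using x x0 by (intro ker) (auto simp: carrier_UP_iff)
    qed (rule that)
    have "x = q \<odot>\<^bsub>UP A\<^esub> y"
      unfolding smult_UP_eq[OF q_closed y(1)] using y(2) by (rule ext)
    also have "\<dots> = up_ring.monom (UP A) q 0 \<otimes>\<^bsub>UP A\<^esub> y"
      using y by (simp add: UA.monom_mult_is_smult)
    finally show "\<exists>y\<in>carrier (UP A). x = up_ring.monom (UP A) q 0 \<otimes>\<^bsub>UP A\<^esub> y"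
      using y by blast
  qed
qed

text \<open>For \<open>a = p \<cdot> 1\<close> this is the reduction \<open>R\<^sub>e \<rightarrow> R\<^sub>1\<close> of Galois rings.\<close>

lemma (in cring) nilpotent_thickening_Quot:
  assumes a: "a \<in> carrier R" and e: "1 \<le> e"
  shows "nilpotent_thickening (R Quot PIdl (a [^] e)) (R Quot PIdl a)
    (\<lambda>C. PIdl a <+>\<^bsub>R\<^esub> C) (PIdl (a [^] e) +> a) e"
proof -
  let ?I = "PIdl (a [^] e)" and ?J = "PIdl a"
  have I: "ideal ?I R" and J: "ideal ?J R"
    using a by (auto intro: cgenideal_ideal)
  have IJ: "?I \<subseteq> ?J"
    using cgenideal_pow_subset[OF a e] .
  note absorb = set_add_coset_absorb[OF I J IJ]
  interpret RI: cring "R Quot ?I" using I is_cring by (rule ideal.quotient_is_cring)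
  interpret RJ: cring "R Quot ?J" using J is_cring by (rule ideal.quotient_is_cring)
  interpret rI: ring_hom_cring R "R Quot ?I" "(+>) ?I" using I is_cring by (rule ideal.rcos_ring_hom_cring)
  have zero: "\<zero>\<^bsub>R Quot ?I\<^esub> = ?I" "\<zero>\<^bsub>R Quot ?J\<^esub> = ?J"
    by (rule zero_Quot)+
  show ?thesis
  proof unfold_locales
    show "(\<lambda>C. ?J <+>\<^bsub>R\<^esub> C) \<in> ring_hom (R Quot ?I) (R Quot ?J)"
      using I J IJ by (rule Quot_projection_ring_hom)
    show "(\<lambda>C. ?J <+>\<^bsub>R\<^esub> C) ` carrier (R Quot ?I) = carrier (R Quot ?J)"
      unfolding carrier_Quot image_image by (rule image_cong) (simp_all add: absorb)
    show "?I +> a \<in> carrier (R Quot ?I)"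
      using a by (simp add: carrier_Quot)
    show "?J <+>\<^bsub>R\<^esub> (?I +> a) = \<zero>\<^bsub>R Quot ?J\<^esub>"
      using a by (simp add: absorb zero coset_eq_ideal_iff[OF J] cgenideal_self)
    show "(?I +> a) [^]\<^bsub>R Quot ?I\<^esub> e = \<zero>\<^bsub>R Quot ?I\<^esub>"
      using a by (simp add: zero coset_eq_ideal_iff[OF I] cgenideal_self flip: rI.hom_pow)
    fix C assume "C \<in> carrier (R Quot ?I)" and 0: "?J <+>\<^bsub>R\<^esub> C = \<zero>\<^bsub>R Quot ?J\<^esub>"
    then obtain x where x: "x \<in> carrier R" and C: "C = ?I +> x"
      by (auto simp: carrier_Quot)
    then have "x \<in> ?J"
      using 0 by (simp add: absorb zero coset_eq_ideal_iff[OF J])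
    then obtain y where y: "y \<in> carrier R" "x = a \<otimes> y"
      using a m_comm unfolding cgenideal_def by blast
    show "\<exists>D\<in>carrier (R Quot ?I). C = (?I +> a) \<otimes>\<^bsub>R Quot ?I\<^esub> D"
    proof
      show "?I +> y \<in> carrier (R Quot ?I)"
        unfolding carrier_Quot using y(1) by (rule imageI)
      show "C = (?I +> a) \<otimes>\<^bsub>R Quot ?I\<^esub> (?I +> y)"
        unfolding C y(2) by (rule mult_coset[OF I a y(1), symmetric])
    qed
  qed
qed

section \<open>Splitting multiplication systems over Galois rings\<close>

lemma (in cring) mult_system_chinese_remainder:
  assumes f: "f \<in> carrier (UP R)" and a: "a \<in> carrier (UP R)" and b: "b \<in> carrier (UP R)"
    and ab: "cring.comaximal (UP R) a b"
  shows "mult_system R f (a \<otimes>\<^bsub>UP R\<^esub> b) \<cong>\<^sub>d mult_system R f b \<otimes>\<^sub>d mult_system R f a"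
proof -
  interpret UP_cring R "UP R" by unfold_locales simp
  let ?P = "UP R"
  let ?ab = "PIdl\<^bsub>?P\<^esub> (a \<otimes>\<^bsub>?P\<^esub> b)" and ?a = "PIdl\<^bsub>?P\<^esub> a" and ?b = "PIdl\<^bsub>?P\<^esub> b"
  let ?\<phi> = "\<lambda>C. (?b <+>\<^bsub>?P\<^esub> C, ?a <+>\<^bsub>?P\<^esub> C)"
  have bij: "bij_betw ?\<phi> (carrier (?P Quot ?ab)) (carrier (?P Quot ?b) \<times> carrier (?P Quot ?a))"
    using a b ab by (rule P.chinese_remainder_bij)
  have ideals: "ideal ?ab ?P" "ideal ?a ?P" "ideal ?b ?P"
    using a b by (auto intro: P.cgenideal_ideal)
  have sub: "?ab \<subseteq> ?a" "?ab \<subseteq> ?b"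
    using a b by (auto dest: P.cgenideal_mult_subset)
  have intertwine: "?\<phi> (mult_map R f (a \<otimes>\<^bsub>?P\<^esub> b) C) = map_prod (mult_map R f b) (mult_map R f a) (?\<phi> C)"
    if C: "C \<in> carrier (?P Quot ?ab)" for C
  proof -
    obtain x where "x \<in> carrier ?P" "C = ?ab +>\<^bsub>?P\<^esub> x"
      using C by (auto simp: P.carrier_Quot)
    then show ?thesis
      using f by (simp add: mult_map_def P.mult_coset P.set_add_coset_absorb ideals sub)
  qed
  show ?thesis
    unfolding dynsys_iso_def dynsys_prod_def mult_system_def fst_conv snd_conv
  proof (intro exI[of _ ?\<phi>] conjI ballI bij)
    fix y assume y: "y \<in> carrier (?P Quot ?b) \<times> carrier (?P Quot ?a)"
    define C where "C = inv_into (carrier (?P Quot ?ab)) ?\<phi> y"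
    have "C \<in> carrier (?P Quot ?ab)" "?\<phi> C = y"
      unfolding C_def using bij_betw_apply[OF bij_betw_inv_into[OF bij] y]
        bij_betw_inv_into_right[OF bij y] by simp_all
    then show "map_prod (mult_map R f b) (mult_map R f a) y = ?\<phi> (mult_map R f (a \<otimes>\<^bsub>?P\<^esub> b) C)"
      using intertwine by metis
  qed
qed

text \<open>Turns the generator \<open>p\<^sup>k \<cdot> 1\<close> of \<^const>\<open>pow_ideal\<close> into the \<open>k\<close>-th power of the ring
  element \<open>p \<cdot> 1\<close>, so that Galois rings are quotients of the form \<open>R/(a\<^sup>k)\<close>.\<close>

lemma (in cring) add_pow_power_one:
  "add_pow R (p ^ k) \<one> = add_pow R (p::nat) \<one> [^] (k::nat)"
proof (induction k)
  case (Suc k)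
  have "add_pow R (p ^ Suc k) \<one> = add_pow R (p ^ k) (add_pow R p \<one>)"
    using add.nat_pow_pow[of \<one> p "p ^ k"] add.nat_pow_pow[of \<one> "p ^ k" p]
    by (simp add: mult.commute)
  also have "\<dots> = add_pow R (p ^ k) \<one> \<otimes> add_pow R p \<one>"
    using add_pow_ldistr[of \<one> "add_pow R p \<one>" "p ^ k"] by simp
  finally show ?case
    using Suc by simp
qed simp

lemma cring_base_ring:
  assumes "h \<in> carrier (UP \<Z>)"
  shows "cring (base_ring h)"
proof -
  interpret UP_cring \<Z> "UP \<Z>"
    by (intro UP_cring.intro int_is_cring) simp
  show ?thesis
    unfolding base_ring_def using assms
    by (intro ideal.quotient_is_cring P.cgenideal_ideal P.is_cring)
qed

theorem corollary2:
  fixes p d e :: nat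
    and h :: "nat \<Rightarrow> int"
    and f m :: "nat \<Rightarrow> (nat \<Rightarrow> int) set"
    and M1 M2 :: "nat \<Rightarrow> (nat \<Rightarrow> int) set set"
  assumes p: "Factorial_Ring.prime p"
    and h: "h \<in> carrier (UP \<Z>)"
    and h_deg: "deg \<Z> h = d" "1 \<le> d"
    and h_monic: "coeff (UP \<Z>) h d = 1"
    and h_irred: "ring_irreducible\<^bsub>UP (ZFact (int p))\<^esub> (map_coeffs (ZMod (int p)) h)"
    and f: "f \<in> carrier (UP (base_ring h))"
    and m: "m \<in> carrier (UP (base_ring h))"
    and deg: "1 \<le> deg (base_ring h) f" "deg (base_ring h) f < deg (base_ring h) m"
    and M1: "M1 \<in> carrier (UP (galois_ring h p 1))"
    and M2: "M2 \<in> carrier (UP (galois_ring h p 1))"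
    and m_eq: "map_coeffs (proj_mod h p 1) m = M1 \<otimes>\<^bsub>UP (galois_ring h p 1)\<^esub> M2"
    and decomp: "f_decomposition (UP (galois_ring h p 1))
      (map_coeffs (proj_mod h p 1) f)
      (PIdl\<^bsub>UP (galois_ring h p 1)\<^esub> (map_coeffs (proj_mod h p 1) m))
      (PIdl\<^bsub>UP (galois_ring h p 1)\<^esub> M1)
      (PIdl\<^bsub>UP (galois_ring h p 1)\<^esub> M2)"
    and e: "1 \<le> e"
  shows "\<exists>m1 \<in> carrier (UP (galois_ring h p e)). \<exists>m2 \<in> carrier (UP (galois_ring h p e)).
    map_coeffs (red_mod h p) m1 = M1 \<and>
    map_coeffs (red_mod h p) m2 = M2 \<and>
    map_coeffs (proj_mod h p e) m = m1 \<otimes>\<^bsub>UP (galois_ring h p e)\<^esub> m2 \<and>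
    mult_system (galois_ring h p e) (map_coeffs (proj_mod h p e) f) (map_coeffs (proj_mod h p e) m)
      \<cong>\<^sub>d mult_system (galois_ring h p e) (map_coeffs (proj_mod h p e) f) m2
         \<otimes>\<^sub>d mult_system (galois_ring h p e) (map_coeffs (proj_mod h p e) f) m1 \<and>
    nilpotent_map (residue_ring_mod (galois_ring h p e) m2)
      (mult_map (galois_ring h p e) (map_coeffs (proj_mod h p e) f) m2) \<and>
    bij_betw (mult_map (galois_ring h p e) (map_coeffs (proj_mod h p e) f) m1)
      (carrier (residue_ring_mod (galois_ring h p e) m1))
      (carrier (residue_ring_mod (galois_ring h p e) m1))"
proof -
  let ?R = "base_ring h" and ?A = "galois_ring h p e" and ?B = "galois_ring h p 1"
  interpret R: cring ?R
    using h by (rule cring_base_ring)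
  define a where "a = add_pow ?R p \<one>\<^bsub>?R\<^esub>"
  have a: "a \<in> carrier ?R"
    unfolding a_def by simp
  have pow: "pow_ideal h p k = PIdl\<^bsub>?R\<^esub> (a [^]\<^bsub>?R\<^esub> k)" for k
    unfolding pow_ideal_def a_def by (simp add: R.add_pow_power_one)
  have pow1: "pow_ideal h p 1 = PIdl\<^bsub>?R\<^esub> a"
    unfolding pow using a by simp
  have I: "ideal (pow_ideal h p k) ?R" for k
    unfolding pow using a by (intro R.cgenideal_ideal) simp
  define q where "q = up_ring.monom (UP ?A) (pow_ideal h p e +>\<^bsub>?R\<^esub> a) 0"
  have thick: "nilpotent_thickening ?A ?B (red_mod h p) (pow_ideal h p e +>\<^bsub>?R\<^esub> a) e"
    using R.nilpotent_thickening_Quot[OF a e]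
    unfolding galois_ring_def red_mod_def[abs_def] pow1 unfolding pow .
  interpret thick: nilpotent_thickening ?A ?B "red_mod h p" "pow_ideal h p e +>\<^bsub>?R\<^esub> a" e
    by (rule thick)
  interpret U: nilpotent_thickening "UP ?A" "UP ?B" "map_coeffs (red_mod h p)" q e
    unfolding q_def by (rule nilpotent_thickening_UP[OF thick])
  have proj: "map_coeffs (proj_mod h p k) z \<in> carrier (UP (galois_ring h p k))"
    if "z \<in> carrier (UP ?R)" for z k
  proof -
    have "ring_hom_cring ?R (galois_ring h p k) (proj_mod h p k)"
      unfolding galois_ring_def proj_mod_def[abs_def] using I R.is_cring
      by (rule ideal.rcos_ring_hom_cring)
    then show ?thesis
      using map_coeffs_ring_hom ring_hom_closed that by metis
  qed
  have sub: "pow_ideal h p e \<subseteq> pow_ideal h p 1"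
    unfolding pow1 unfolding pow using a e by (rule R.cgenideal_pow_subset)
  have red_proj: "map_coeffs (red_mod h p) (map_coeffs (proj_mod h p e) z) = map_coeffs (proj_mod h p 1) z"
    if "z \<in> carrier (UP ?R)" for z
  proof
    fix i
    have "z i \<in> carrier ?R"
      using that by (simp add: carrier_UP_iff)
    then show "map_coeffs (red_mod h p) (map_coeffs (proj_mod h p e) z) i = map_coeffs (proj_mod h p 1) z i"
      using R.set_add_coset_absorb[OF I I sub] by (simp add: map_coeffs_def red_mod_def proj_mod_def)
  qed
  define fe where "fe = map_coeffs (proj_mod h p e) f"
  define me where "me = map_coeffs (proj_mod h p e) m"
  define F where "F = map_coeffs (proj_mod h p 1) f"
  have fe: "fe \<in> carrier (UP ?A)" "map_coeffs (red_mod h p) fe = F"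
    unfolding fe_def F_def using f proj red_proj by auto
  have me: "me \<in> carrier (UP ?A)" "map_coeffs (red_mod h p) me = M1 \<otimes>\<^bsub>UP ?B\<^esub> M2"
    unfolding me_def using m proj red_proj m_eq by auto
  have F: "F \<in> carrier (UP ?B)"
    unfolding F_def using f by (rule proj)
  have F_M1: "U.S.comaximal F M1"
    unfolding U.S.comaximal_iff_coprime_ideals[OF F M1]
    using decomp unfolding f_decomposition_def F_def by blast
  obtain n where F_M2: "F [^]\<^bsub>UP ?B\<^esub> (n::nat) \<in> PIdl\<^bsub>UP ?B\<^esub> M2"
    using decomp unfolding f_decomposition_def rad_ideal_def F_def by blast
  then obtain c where c: "c \<in> carrier (UP ?B)" "F [^]\<^bsub>UP ?B\<^esub> n = c \<otimes>\<^bsub>UP ?B\<^esub> M2"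
    unfolding cgenideal_def by blast
  have "U.S.comaximal M2 M1"
    using U.S.comaximal_pow[OF F_M1 F M1, of n] unfolding c(2)
    by (rule U.S.comaximal_dvd[OF _ M2 M1 c(1)])
  then have M12: "U.S.comaximal M1 M2"
    by (rule U.S.comaximal_sym[OF M2 M1])
  obtain m1 m2 where m1: "m1 \<in> carrier (UP ?A)" "map_coeffs (red_mod h p) m1 = M1"
    and m2: "m2 \<in> carrier (UP ?A)" "map_coeffs (red_mod h p) m2 = M2"
    and m12: "me = m1 \<otimes>\<^bsub>UP ?A\<^esub> m2"
    using U.hensel_factorization[OF me(1) M1 M2 M12 me(2)] by metis
  have co12: "U.R.comaximal m1 m2"
    using M12 unfolding m1(2)[symmetric] m2(2)[symmetric] by (rule U.comaximal_lift[OF m1(1) m2(1)])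
  have cof: "U.R.comaximal fe m1"
    using F_M1 unfolding fe(2)[symmetric] m1(2)[symmetric] by (rule U.comaximal_lift[OF fe(1) m1(1)])
  have "(fe [^]\<^bsub>UP ?A\<^esub> n) [^]\<^bsub>UP ?A\<^esub> e \<in> PIdl\<^bsub>UP ?A\<^esub> m2"
  proof (rule U.pow_mem_PIdl_lift)
    show "map_coeffs (red_mod h p) (fe [^]\<^bsub>UP ?A\<^esub> n) \<in> PIdl\<^bsub>UP ?B\<^esub> (map_coeffs (red_mod h p) m2)"
      using F_M2 unfolding U.hom_pow[OF fe(1)] fe(2) m2(2) .
  qed (use fe(1) m2(1) in simp_all)
  then have nil: "fe [^]\<^bsub>UP ?A\<^esub> (n * e) \<in> PIdl\<^bsub>UP ?A\<^esub> m2"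
    using fe by (simp add: U.R.nat_pow_pow)
  have "mult_system ?A fe me \<cong>\<^sub>d mult_system ?A fe m2 \<otimes>\<^sub>d mult_system ?A fe m1"
    unfolding m12 using fe(1) m1(1) m2(1) co12 by (rule thick.R.mult_system_chinese_remainder)
  moreover have "nilpotent_map (residue_ring_mod ?A m2) (mult_map ?A fe m2)"
    unfolding nilpotent_map_def mult_map_def[abs_def]
    using U.R.mult_funpow_eq_zero[OF fe(1) m2(1) nil] by blast
  moreover have "bij_betw (mult_map ?A fe m1) (carrier (residue_ring_mod ?A m1)) (carrier (residue_ring_mod ?A m1))"
    unfolding mult_map_def[abs_def] using fe(1) m1(1) cof by (rule U.R.mult_comaximal_bij)
  ultimately show ?thesis
    using m1 m2 m12 unfolding fe_def me_def by blast
qed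

end
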